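(* Let $q$ be a prime power, let $x$ be a positive integer, and let $\mathcal{L}$ be a set of lines of $\mathrm{AG}(3,q)$ with $|\mathcal{L}|=x(q^2+q+1)$. Let $A$ be the point-line incidence matrix of $\mathrm{AG}(3,q)$ and let $\chi_{\mathcal{L}}$ be the characteristic vector of $\mathcal{L}$. Then the following properties are equivalent. \begin{enumerate} \item For every line spread $\mathcal{S}$ of $\mathrm{AG}(3,q)$, $|\mathcal{L}\cap\mathcal{S}|=x$. \item $\chi_{\mathcal{L}}\in(\ker(A))^\perp$. \item $\chi_{\mathcal{L}}\in\mathrm{Im}(A^T)$. \item For every pair of conjugated switching sets $\mathcal{R}$ and $\mathcal{R}'$ in $\mathrm{AG}(3,q)$, $|\mathcal{L}\cap\mathcal{R}|=|\mathcal{L}\cap\mathcal{R}'|$. \item For every line $\ell$ of $\mathrm{AG}(3,q)$, the number of elements of $\mathcal{L}$ disjoint from $\ell$ (in $\mathrm{AG}(3,q)$) is equal to $(q^2+1)(x-\chi_{\mathcal{L}}(\ell))$, and through every point at infinity there are exactly $x$ lines of $\mathcal{L}$. Here $\chi_{\mathcal{L}}(\ell)=1$ if $\ell\in\mathcal{L}$ and $\chi_{\mathcal{L}}(\ell)=0$ otherwise. \end{enumerate}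
   Context: $\mathrm{AG}(3,q)$ is the 3-dimensional affine space over $\mathbb{F}_q$, obtained from the projective space $\mathrm{PG}(3,q)$ by removing a plane $\pi_\infty$ (the plane at infinity); lines of $\mathrm{AG}(3,q)$ are identified with lines of $\mathrm{PG}(3,q)$ not contained in $\pi_\infty$, and a point at infinity is a point of $\pi_\infty$. A partial line spread is a set of pairwise disjoint lines. A line spread of $\mathrm{AG}(3,q)$ is a partial line spread that partitions the points of $\mathrm{AG}(3,q)$. A pair of conjugated switching sets consists of two disjoint partial line spreads (i.e. having no line in common) that cover the same set of points. In $\mathrm{AG}(3,q)$, disjointness of lines means that they have no affine point in common (so distinct parallel lines are disjoint). The point-line incidence matrix $A$ is the $0/1$ matrix over $\mathbb{C}$ with rows indexed by the points and columns indexed by the lines of $\mathrm{AG}(3,q)$, with entry $1$ exactly when the point lies on the line. The characteristic vector $\chi_{\mathcal{L}}$ is the $0/1$ vector indexed by the lines of $\mathrm{AG}(3,q)$ with entry $1$ exactly at the lines in $\mathcal{L}$. *)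

theory Defs
  imports "HOL-Analysis.Analysis"
begin

text \<open>
  The field with \<open>q\<close> elements is a type \<open>'a :: {field, finite}\<close> with \<open>CARD('a) = q\<close>; its
  cardinality is automatically a prime power. The \<open>k\<close>-dimensional linear subspaces of \<open>'a ^ 4\<close> for
  \<open>k = 1, 2, 3\<close> are the points, lines and planes of \<open>PG(3,q)\<close>, and incidence is inclusion.
  Note that distinct projective points are sets meeting in the zero vector, so set-theoretic
  disjointness of subspaces plays no role below.
\<close>

type_synonym 'a pg = "('a ^ 4) set"

definition pg_points :: "'a::{field,finite} pg set" where
  "pg_points = {P. vec.subspace P \<and> vec.dim P = 1}"

definition pg_lines :: "'a::{field,finite} pg set" where
  "pg_lines = {l. vec.subspace l \<and> vec.dim l = 2}"

definition pg_planes :: "'a::{field,finite} pg set" where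
  "pg_planes = {\<pi>. vec.subspace \<pi> \<and> vec.dim \<pi> = 3}"

text \<open>\<open>AG(3,q)\<close> is \<open>PG(3,q)\<close> with the plane \<open>\<pi>\<close> removed.\<close>

definition ag_points :: "'a::{field,finite} pg \<Rightarrow> 'a pg set" where
  "ag_points \<pi> = {P \<in> pg_points. \<not> P \<subseteq> \<pi>}"

definition ag_lines :: "'a::{field,finite} pg \<Rightarrow> 'a pg set" where
  "ag_lines \<pi> = {l \<in> pg_lines. \<not> l \<subseteq> \<pi>}"

definition points_at_infinity :: "'a::{field,finite} pg \<Rightarrow> 'a pg set" where
  "points_at_infinity \<pi> = {P \<in> pg_points. P \<subseteq> \<pi>}"

definition ag_disjoint :: "'a::{field,finite} pg \<Rightarrow> 'a pg \<Rightarrow> 'a pg \<Rightarrow> bool" where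
  "ag_disjoint \<pi> l m \<longleftrightarrow> \<not> (\<exists>P \<in> ag_points \<pi>. P \<subseteq> l \<and> P \<subseteq> m)"

definition covered_points :: "'a::{field,finite} pg \<Rightarrow> 'a pg set \<Rightarrow> 'a pg set" where
  "covered_points \<pi> \<R> = {P \<in> ag_points \<pi>. \<exists>l \<in> \<R>. P \<subseteq> l}"

definition partial_line_spread :: "'a::{field,finite} pg \<Rightarrow> 'a pg set \<Rightarrow> bool" where
  "partial_line_spread \<pi> \<R> \<longleftrightarrow> \<R> \<subseteq> ag_lines \<pi> \<and> pairwise (ag_disjoint \<pi>) \<R>"

definition line_spread :: "'a::{field,finite} pg \<Rightarrow> 'a pg set \<Rightarrow> bool" where
  "line_spread \<pi> \<S> \<longleftrightarrow> partial_line_spread \<pi> \<S> \<and> covered_points \<pi> \<S> = ag_points \<pi>"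

definition conjugated_switching_sets ::
    "'a::{field,finite} pg \<Rightarrow> 'a pg set \<Rightarrow> 'a pg set \<Rightarrow> bool" where
  "conjugated_switching_sets \<pi> \<R> \<R>' \<longleftrightarrow>
     partial_line_spread \<pi> \<R> \<and> partial_line_spread \<pi> \<R>' \<and> \<R> \<inter> \<R>' = {} \<and>
     covered_points \<pi> \<R> = covered_points \<pi> \<R>'"

text \<open>
  A complex matrix with rows indexed by a finite set \<open>I\<close> and columns indexed by a finite set \<open>J\<close>
  is a function of two arguments, of which only the values on \<open>I \<times> J\<close> matter. The space of
  complex vectors indexed by \<open>I\<close> is represented by the functions vanishing outside \<open>I\<close>.
\<close>

definition cvectors :: "'i set \<Rightarrow> ('i \<Rightarrow> complex) set" where
  "cvectors I = {v. \<forall>i. i \<notin> I \<longrightarrow> v i = 0}"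

definition mat_ker :: "'i set \<Rightarrow> 'j set \<Rightarrow> ('i \<Rightarrow> 'j \<Rightarrow> complex) \<Rightarrow> ('j \<Rightarrow> complex) set" where
  "mat_ker I J M = {v \<in> cvectors J. \<forall>i\<in>I. (\<Sum>j\<in>J. M i j * v j) = 0}"

definition mat_im :: "'i set \<Rightarrow> 'j set \<Rightarrow> ('i \<Rightarrow> 'j \<Rightarrow> complex) \<Rightarrow> ('i \<Rightarrow> complex) set" where
  "mat_im I J M = {w \<in> cvectors I. \<exists>v \<in> cvectors J. \<forall>i\<in>I. w i = (\<Sum>j\<in>J. M i j * v j)}"

definition mat_transpose :: "('i \<Rightarrow> 'j \<Rightarrow> complex) \<Rightarrow> 'j \<Rightarrow> 'i \<Rightarrow> complex" where
  "mat_transpose M = (\<lambda>j i. M i j)"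

definition orth_compl :: "'i set \<Rightarrow> ('i \<Rightarrow> complex) set \<Rightarrow> ('i \<Rightarrow> complex) set" where
  "orth_compl I W = {v \<in> cvectors I. \<forall>w\<in>W. (\<Sum>i\<in>I. v i * cnj (w i)) = 0}"

text \<open>
  For \<open>\<L> \<subseteq> ag_lines \<pi>\<close> the characteristic vector of \<open>\<L>\<close> is
  \<open>indicator \<L> \<in> cvectors (ag_lines \<pi>)\<close>.
\<close>

definition incidence_matrix :: "'a::{field,finite} pg \<Rightarrow> 'a pg \<Rightarrow> complex" where
  "incidence_matrix P l = (if P \<subseteq> l then 1 else 0)"

definition all_equivalent :: "bool list \<Rightarrow> bool" where
  "all_equivalent ps \<longleftrightarrow> (\<forall>p \<in> set ps. \<forall>p' \<in> set ps. p \<longleftrightarrow> p')"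

end

theory Submission imports Defs begin

text \<open>
  Let \<open>n(\<tau>, d)\<close> be the number of lines of \<open>\<L>\<close> in the plane \<open>\<tau>\<close> through the point at infinity \<open>d\<close>.
  Replacing in the parallel class of \<open>d\<close> the lines inside \<open>\<tau>\<close> by those of another direction \<open>e\<close>
  of \<open>\<tau>\<close> gives a line spread again, so under (1) the number \<open>n(\<tau>, d)\<close> depends only on \<open>\<tau>\<close>.
  For a line \<open>l\<close> of direction \<open>d\<close>, the lines of direction \<open>e \<noteq> d\<close> meeting \<open>l\<close> are those in the plane
  \<open>\<langle>l, e\<rangle>\<close>, so there are \<open>n(\<langle>l, e\<rangle>, e) = n(\<langle>l, e\<rangle>, d)\<close> of them in \<open>\<L>\<close>. Summing over \<open>e\<close> counts only
  lines parallel to \<open>l\<close>, of which \<open>\<L>\<close> has \<open>x\<close>, and yields (5). Conversely (5) says that the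
  numbers of lines of \<open>\<L>\<close> through the points of \<open>l\<close> add up to \<open>q x + (q\<^sup>2 + q) \<chi>(l)\<close>, so that
  \<open>(deg P - x) / (q\<^sup>2 + q)\<close> is a preimage of \<open>\<chi>\<close> under the transposed incidence matrix. The remaining
  implications (3) \<open>\<Longrightarrow>\<close> (2) \<open>\<Longrightarrow>\<close> (4) \<open>\<Longrightarrow>\<close> (1) are formal; the last one uses that the parallel
  classes are \<open>q\<^sup>2 + q + 1\<close> spreads partitioning the lines.
\<close>

section \<open>Images of transposes and orthogonal complements of kernels\<close>

text \<open>Moving the matrix to the other side of the inner product turns a product with
  \<open>M\<^sup>T u\<close> into one with \<open>M w = 0\<close>. Entries have to be real because
  the inner product conjugates while the transpose does not.\<close>

lemma mat_im_transpose_subset_orth_compl: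
  assumes "\<And>i j. i \<in> I \<Longrightarrow> j \<in> J \<Longrightarrow> M i j \<in> \<real>"
  shows "mat_im J I (mat_transpose M) \<subseteq> orth_compl J (mat_ker I J M)"
proof
  fix v assume "v \<in> mat_im J I (mat_transpose M)"
  then obtain u where v: "v \<in> cvectors J" and u: "\<forall>j\<in>J. v j = (\<Sum>i\<in>I. M i j * u i)"
    by (auto simp: mat_im_def mat_transpose_def)
  have "(\<Sum>j\<in>J. v j * cnj (w j)) = 0" if w: "w \<in> mat_ker I J M" for w
  proof -
    have "(\<Sum>j\<in>J. v j * cnj (w j)) = (\<Sum>j\<in>J. \<Sum>i\<in>I. u i * cnj (M i j * w j))"
      using u assms by (auto simp: sum_distrib_right sum_distrib_left Reals_cnj_iff ac_simps intro!: sum.cong)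
    also have "\<dots> = (\<Sum>i\<in>I. u i * cnj (\<Sum>j\<in>J. M i j * w j))"
      by (subst sum.swap) (simp add: sum_distrib_left)
    also have "\<dots> = 0" using w by (simp add: mat_ker_def)
    finally show ?thesis .
  qed
  with v show "v \<in> orth_compl J (mat_ker I J M)" by (simp add: orth_compl_def)
qed

section \<open>Counting vectors and projective points\<close>

text \<open>Induction over a basis: each new basis vector \<open>b\<close> multiplies the size of
  the span by \<open>CARD('a)\<close>, as \<open>(c, v)\<close> maps bijectively to
  \<open>c *s b + v\<close>. Injectivity holds because two different coefficients would put
  \<open>b\<close> into the old span.\<close>

lemma card_subspace:
  fixes U :: "('a::{field,finite} ^ 'n::finite) set"
  assumes "vec.subspace U"
  shows "card U = CARD('a) ^ vec.dim U"
proof -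
  have span: "card (vec.span B) = CARD('a) ^ card B" if "vec.independent B"
    for B :: "('a ^ 'n) set"
    using finite that
  proof (induction B rule: finite_induct)
    case (insert b B)
    then have b: "b \<notin> vec.span B" and B: "vec.independent B"
      using vec.independent_insert[of b B] by auto
    let ?f = "\<lambda>(c, v). c *s b + v"
    have "vec.span (insert b B) = ?f ` (UNIV \<times> vec.span B)"
    proof (intro equalityI subsetI)
      fix x assume "x \<in> vec.span (insert b B)"
      then obtain k where "x - k *s b \<in> vec.span B"
        unfolding vec.span_breakdown_eq by blast
      then show "x \<in> ?f ` (UNIV \<times> vec.span B)"
        by (intro image_eqI[where x = "(k, x - k *s b)"]) auto
    qed (auto simp: vec.span_breakdown_eq, metis add_diff_cancel_left')
    moreover have "inj_on ?f (UNIV \<times> vec.span B)"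
    proof (rule inj_onI, clarify)
      fix c v d w
      assume *: "v \<in> vec.span B" "w \<in> vec.span B" "c *s b + v = d *s b + w"
      have eq: "(c - d) *s b = w - v"
        using *(3) by (simp add: vec.scale_left_diff_distrib algebra_simps)
      have "c = d"
      proof (rule ccontr)
        assume "c \<noteq> d"
        then have "b = inverse (c - d) *s ((c - d) *s b)"
          by (simp only: vec.scale_scale) simp
        then have "b = inverse (c - d) *s (w - v)"
          unfolding eq .
        then show False
          using b * by (metis vec.span_diff vec.span_scale)
      qed
      then show "c = d \<and> v = w" using * by simp
    qed
    ultimately show ?case
      using insert B by (simp add: card_image card_cartesian_product)
  qed simp
  obtain B where "vec.independent B" "vec.span B = U" "card B = vec.dim U"
    using vec.basis_subspace_exists[OF assms] by metis
  with span show ?thesis by metis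
qed

lemma CARD_field_ge_2: "CARD('a::{field,finite}) \<ge> 2"
proof -
  have "card {0, 1::'a} \<le> CARD('a)" by (intro card_mono) auto
  then show ?thesis by simp
qed

lemma points_eq_if_common_vector:
  assumes "P \<in> pg_points" "Q \<in> pg_points" "v \<in> P" "v \<in> Q" "v \<noteq> 0"
  shows "P = Q"
proof -
  have "R = vec.span {v}" if "R \<in> pg_points" "v \<in> R" for R
  proof -
    have "vec.span {v} \<subseteq> R" "vec.dim R \<le> vec.dim (vec.span {v})"
      using that \<open>v \<noteq> 0\<close> by (auto simp: pg_points_def vec.span_minimal)
    then show ?thesis
      using vec.subspace_dim_equal[of "vec.span {v}" R] that by (auto simp: pg_points_def)
  qed
  with assms show ?thesis by blast
qed

text \<open>The points of \<open>U\<close> partition its nonzero vectors into classes of size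
  \<open>CARD('a) - 1\<close>. The zero vector accounts for the \<open>+ 1\<close>, and the product
  form avoids a division.\<close>

lemma card_points_in_subspace:
  fixes U :: "'a::{field,finite} pg"
  assumes "vec.subspace U"
  shows "card {P \<in> pg_points. P \<subseteq> U} * (CARD('a) - 1) + 1 = CARD('a) ^ vec.dim U"
proof -
  let ?S = "{P \<in> pg_points. P \<subseteq> U}"
  have "U - {0} = (\<Union>P\<in>?S. P - {0})"
  proof (intro equalityI subsetI)
    fix v assume v: "v \<in> U - {0}"
    then have "vec.span {v} \<in> ?S"
      using assms by (auto simp: pg_points_def vec.span_minimal)
    then show "v \<in> (\<Union>P\<in>?S. P - {0})"
      using v vec.span_base[of v "{v}"] by blast
  qed auto
  also have "card \<dots> = (\<Sum>P\<in>?S. card (P - {0}))"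
    by (intro card_UN_disjoint ballI impI) (auto dest: points_eq_if_common_vector)
  also have "\<dots> = (\<Sum>P\<in>?S. CARD('a) - 1)"
  proof (intro sum.cong refl)
    fix P assume "P \<in> ?S"
    then show "card (P - {0}) = CARD('a) - 1"
      using card_subspace[of P] vec.subspace_0[of P] by (simp add: pg_points_def)
  qed
  finally have "card (U - {0}) = card ?S * (CARD('a) - 1)" by simp
  moreover have "card U = card (U - {0}) + 1"
    using vec.subspace_0[OF assms] card_Suc_Diff1[of U 0] by simp
  ultimately show ?thesis
    using card_subspace[OF assms] by simp
qed

lemma card_points_in_line:
  fixes l :: "'a::{field,finite} pg"
  assumes "vec.subspace l" "vec.dim l = 2"
  shows "card {P \<in> pg_points. P \<subseteq> l} = CARD('a) + 1"
proof -
  \<comment> \<open>Writing the field size as \<open>k + 2\<close> removes the natural subtraction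
    and makes the factor \<open>k + 1\<close> visibly nonzero, so that it cancels.\<close>
  obtain k where k: "CARD('a) = Suc (Suc k)"
    using CARD_field_ge_2[where 'a='a] by (metis add_2_eq_Suc le_Suc_ex)
  have "card {P \<in> pg_points. P \<subseteq> l} * (k + 1) = (k + 3) * (k + 1)"
    using card_points_in_subspace[OF assms(1)] assms(2)
    by (simp add: k power2_eq_square algebra_simps)
  then have "card {P \<in> pg_points. P \<subseteq> l} = k + 3"
    unfolding mult_cancel2 by simp
  then show ?thesis by (simp add: k)
qed

lemma card_points_in_plane:
  fixes \<tau> :: "'a::{field,finite} pg"
  assumes "vec.subspace \<tau>" "vec.dim \<tau> = 3"
  shows "card {P \<in> pg_points. P \<subseteq> \<tau>} = CARD('a)^2 + CARD('a) + 1"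
proof -
  obtain k where k: "CARD('a) = Suc (Suc k)"
    using CARD_field_ge_2[where 'a='a] by (metis add_2_eq_Suc le_Suc_ex)
  have "card {P \<in> pg_points. P \<subseteq> \<tau>} * (k + 1) = ((k + 2)^2 + (k + 2) + 1) * (k + 1)"
    using card_points_in_subspace[OF assms(1)] assms(2)
    by (simp add: k power2_eq_square power3_eq_cube algebra_simps)
  then have "card {P \<in> pg_points. P \<subseteq> \<tau>} = (k + 2)^2 + (k + 2) + 1"
    unfolding mult_cancel2 by simp
  then show ?thesis by (simp add: k)
qed

section \<open>Joins and the dimension formula\<close>

definition join :: "'a::{field,finite} pg \<Rightarrow> 'a pg \<Rightarrow> 'a pg" where
  "join U V = vec.span (U \<union> V)"

lemma join_upper: "U \<subseteq> join U V" "V \<subseteq> join U V"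
  using vec.span_superset[of "U \<union> V"] by (auto simp: join_def)

lemma join_least: "vec.subspace W \<Longrightarrow> U \<subseteq> W \<Longrightarrow> V \<subseteq> W \<Longrightarrow> join U V \<subseteq> W"
  by (simp add: join_def vec.span_minimal)

lemma subspace_join [simp]: "vec.subspace (join U V)"
  by (simp add: join_def)

text \<open>The span of the union is the sum of the two subspaces, so this is Grassmann's
  formula.\<close>

lemma dim_join:
  assumes "vec.subspace U" "vec.subspace V"
  shows "vec.dim (join U V) + vec.dim (U \<inter> V) = vec.dim U + vec.dim V"
proof -
  have span: "vec.span U = U" "vec.span V = V"
    using assms vec.span_eq_iff by blast+
  have "join U V = {u + v |u v. u \<in> U \<and> v \<in> V}"
    unfolding join_def vec.span_Un span ..
  then show ?thesis using vec.dim_sums_Int[OF assms] by simp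
qed

lemma subspace_eqI:
  fixes U V :: "('a::field ^ 'n::finite) set"
  assumes "vec.subspace U" "vec.subspace V" "U \<subseteq> V" "vec.dim V \<le> vec.dim U"
  shows "U = V"
  using vec.subspace_dim_equal assms by blast

lemma join_eqI:
  assumes "vec.subspace W" "U \<subseteq> W" "V \<subseteq> W" "vec.dim W \<le> vec.dim (join U V)"
  shows "join U V = W"
  using assms by (intro subspace_eqI join_least) auto

lemma points_Int_dim:
  assumes "P \<in> pg_points" "vec.subspace U" "\<not> P \<subseteq> U"
  shows "vec.dim (P \<inter> U) = 0"
proof -
  have P: "vec.subspace P" "vec.dim P = 1" using assms by (auto simp: pg_points_def)
  have "vec.dim (P \<inter> U) < 1"
    using subspace_eqI[of "P \<inter> U" P] P assms vec.subspace_inter[of P U]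
    by (metis Int_lower1 inf.absorb_iff1 not_less)
  then show ?thesis by simp
qed

lemma dim_join_point:
  assumes "P \<in> pg_points" "vec.subspace U" "\<not> P \<subseteq> U"
  shows "vec.dim (join U P) = vec.dim U + 1"
  using dim_join[of U P] points_Int_dim[OF assms] assms
  by (simp add: pg_points_def Int_commute)

lemma points_subset_eq:
  assumes "P \<in> pg_points" "Q \<in> pg_points" "P \<subseteq> Q"
  shows "P = Q"
  using assms by (intro subspace_eqI) (auto simp: pg_points_def)

text \<open>The join of the two points is already two-dimensional, hence equal to each line
  containing both.\<close>

lemma lines_eq_if_two_points:
  assumes "l \<in> pg_lines" "m \<in> pg_lines" "P \<in> pg_points" "Q \<in> pg_points" "P \<noteq> Q"
    and "P \<subseteq> l" "Q \<subseteq> l" "P \<subseteq> m" "Q \<subseteq> m"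
  shows "l = m"
proof -
  have "\<not> Q \<subseteq> P" using points_subset_eq assms by blast
  then have "vec.dim (join P Q) = 2"
    using dim_join_point[of Q P] assms by (auto simp: pg_points_def)
  then have "join P Q = l" "join P Q = m"
    using assms join_eqI[of l P Q] join_eqI[of m P Q] by (simp_all add: pg_lines_def)
  then show ?thesis by simp
qed

section \<open>Affine lines and their directions\<close>

locale affine_space =
  fixes \<pi> :: "'a::{field,finite} pg"
  assumes plane: "\<pi> \<in> pg_planes"
begin

lemma subspace_\<pi>: "vec.subspace \<pi>" and dim_\<pi>: "vec.dim \<pi> = 3"
  using plane by (auto simp: pg_planes_def)

text \<open>The join of \<open>U\<close> with the plane properly contains the plane, so it is the
  whole four-dimensional space; Grassmann's formula does the rest.\<close>

lemma dim_Int_\<pi>: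
  assumes "vec.subspace U" "\<not> U \<subseteq> \<pi>"
  shows "vec.dim (U \<inter> \<pi>) + 1 = vec.dim U"
proof -
  have "\<not> vec.dim (join U \<pi>) \<le> 3"
    using subspace_eqI[of \<pi> "join U \<pi>"] join_upper[of U \<pi>] join_upper[of \<pi> U] assms
      subspace_\<pi> dim_\<pi> by auto
  moreover have "vec.dim (join U \<pi>) \<le> 4"
    using dim_subset_UNIV_cart_gen[of "join U \<pi>"] by simp
  ultimately show ?thesis
    using dim_join[OF assms(1) subspace_\<pi>] dim_\<pi> by simp
qed

lemma ag_linesD:
  assumes "l \<in> ag_lines \<pi>"
  shows "vec.subspace l" "vec.dim l = 2" "\<not> l \<subseteq> \<pi>" "l \<in> pg_lines"
  using assms by (auto simp: ag_lines_def pg_lines_def)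

text \<open>From here on \<open>l \<inter> \<pi>\<close> serves as the direction of the affine line
  \<open>l\<close>; parallel lines are those with the same direction.\<close>

lemma direction_in_points_at_infinity:
  "l \<in> ag_lines \<pi> \<Longrightarrow> l \<inter> \<pi> \<in> points_at_infinity \<pi>"
  using dim_Int_\<pi>[of l] subspace_\<pi> vec.subspace_inter[of l \<pi>] ag_linesD[of l]
  by (simp add: points_at_infinity_def pg_points_def)

lemma direction_eq_iff:
  assumes "l \<in> ag_lines \<pi>" "d \<in> points_at_infinity \<pi>"
  shows "l \<inter> \<pi> = d \<longleftrightarrow> d \<subseteq> l"
  using direction_in_points_at_infinity[OF assms(1)] assms(2) points_subset_eq[of d "l \<inter> \<pi>"]
  by (auto simp: points_at_infinity_def)

lemma ag_lines_eqI:
  assumes "l \<in> ag_lines \<pi>" "m \<in> ag_lines \<pi>" "P \<in> ag_points \<pi>" "d \<in> points_at_infinity \<pi>"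
    and "P \<subseteq> l" "P \<subseteq> m" "d \<subseteq> l" "d \<subseteq> m"
  shows "l = m"
proof (rule lines_eq_if_two_points)
  show "P \<noteq> d" using assms by (auto simp: ag_points_def points_at_infinity_def)
qed (use assms in \<open>auto simp: ag_lines_def ag_points_def points_at_infinity_def\<close>)

lemma join_in_ag_lines:
  assumes "P \<in> ag_points \<pi>" "d \<in> points_at_infinity \<pi>"
  shows "join P d \<in> ag_lines \<pi>"
proof -
  have "\<not> d \<subseteq> P"
    using assms points_subset_eq[of d P] by (auto simp: ag_points_def points_at_infinity_def)
  then show ?thesis
    using dim_join_point[of d P] assms join_upper[of P d]
    by (auto simp: ag_points_def points_at_infinity_def ag_lines_def pg_lines_def pg_points_def)
qed

lemma ag_disjoint_sym: "ag_disjoint \<pi> l m = ag_disjoint \<pi> m l"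
  by (auto simp: ag_disjoint_def)

lemma ag_disjoint_parallel:
  assumes "l \<in> ag_lines \<pi>" "m \<in> ag_lines \<pi>" "l \<noteq> m" "d \<in> points_at_infinity \<pi>" "d \<subseteq> l" "d \<subseteq> m"
  shows "ag_disjoint \<pi> l m"
  using ag_lines_eqI assms unfolding ag_disjoint_def by blast

lemma card_points_at_infinity: "card (points_at_infinity \<pi>) = CARD('a)^2 + CARD('a) + 1"
  using card_points_in_plane[OF subspace_\<pi> dim_\<pi>] by (simp add: points_at_infinity_def)

lemma card_ag_points_in_line:
  assumes "l \<in> ag_lines \<pi>"
  shows "card {P \<in> ag_points \<pi>. P \<subseteq> l} = CARD('a)"
proof -
  have d: "l \<inter> \<pi> \<in> pg_points"
    using direction_in_points_at_infinity[OF assms] by (simp add: points_at_infinity_def)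
  \<comment> \<open>Of the \<open>CARD('a) + 1\<close> projective points of \<open>l\<close>,
    exactly the direction is lost.\<close>
  have "P \<subseteq> \<pi> \<longleftrightarrow> P = l \<inter> \<pi>" if "P \<in> pg_points" "P \<subseteq> l" for P
    using that d points_subset_eq[of P "l \<inter> \<pi>"] by blast
  then have "{P \<in> ag_points \<pi>. P \<subseteq> l} = {P \<in> pg_points. P \<subseteq> l} - {l \<inter> \<pi>}"
    unfolding ag_points_def by blast
  then show ?thesis
    using card_points_in_line[of l] ag_linesD[OF assms] d by simp
qed

lemma card_common_ag_points:
  assumes "l \<in> ag_lines \<pi>" "m \<in> ag_lines \<pi>" "l \<noteq> m" "\<not> ag_disjoint \<pi> l m"
  shows "card {P \<in> ag_points \<pi>. P \<subseteq> l \<and> P \<subseteq> m} = 1"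
proof -
  obtain P where P: "P \<in> ag_points \<pi>" "P \<subseteq> l" "P \<subseteq> m"
    using assms by (auto simp: ag_disjoint_def)
  have "Q = P" if "Q \<in> ag_points \<pi>" "Q \<subseteq> l" "Q \<subseteq> m" for Q
    using P that assms(1-3) lines_eq_if_two_points[of l m P Q]
    unfolding ag_points_def ag_lines_def by blast
  then have "{P \<in> ag_points \<pi>. P \<subseteq> l \<and> P \<subseteq> m} = {P}" using P by blast
  then show ?thesis by simp
qed

section \<open>Coplanar lines\<close>

lemma dim_join_line_infinity:
  assumes "l \<in> ag_lines \<pi>" "e \<in> points_at_infinity \<pi>" "e \<noteq> l \<inter> \<pi>"
  shows "vec.dim (join l e) = 3"
proof -
  have "\<not> e \<subseteq> l" using direction_eq_iff assms by blast
  then show ?thesis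
    using dim_join_point[of e l] assms ag_linesD[of l] by (auto simp: points_at_infinity_def)
qed

text \<open>If \<open>m\<close> meets \<open>l\<close> in \<open>P\<close>, then \<open>m\<close> is
  the join of \<open>P\<close> and \<open>e\<close>, which lies in the plane. Conversely, two lines
  of a plane share a projective point, and here it is affine because the directions differ.\<close>

lemma meet_iff_coplanar:
  assumes "l \<in> ag_lines \<pi>" "m \<in> ag_lines \<pi>" "e \<in> points_at_infinity \<pi>" "e \<noteq> l \<inter> \<pi>" "e \<subseteq> m"
  shows "\<not> ag_disjoint \<pi> m l \<longleftrightarrow> m \<subseteq> join l e"
proof
  assume "\<not> ag_disjoint \<pi> m l"
  then obtain P where P: "P \<in> ag_points \<pi>" "P \<subseteq> m" "P \<subseteq> l" by (auto simp: ag_disjoint_def)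
  have "join P e = m"
    using ag_lines_eqI[of "join P e" m P e] join_in_ag_lines join_upper P assms by blast
  then show "m \<subseteq> join l e"
    using join_least[of "join l e" P e] join_upper P by (metis subspace_join order_trans)
next
  note l = ag_linesD[OF assms(1)] and m = ag_linesD[OF assms(2)]
  assume "m \<subseteq> join l e"
  have e: "m \<inter> \<pi> = e" using direction_eq_iff assms by blast
  have "join l m \<subseteq> join l e" using \<open>m \<subseteq> join l e\<close> join_upper[of l e] by (intro join_least) auto
  then have "vec.dim (join l m) \<le> 3"
    using dim_join_line_infinity[OF assms(1,3,4)] vec.dim_subset[of "join l m"] by metis
  then have "vec.dim (l \<inter> m) > 0"
    \<comment> \<open>Two plus two minus at most three leaves an intersection of dimension at least
      one.\<close>
    using dim_join[of l m] l m by simp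
  then have "\<not> l \<inter> m \<subseteq> {0}" by (metis vec.dim_eq_0 less_irrefl)
  then obtain v where v: "v \<in> l" "v \<in> m" "v \<noteq> 0" by blast
  let ?P = "vec.span {v}"
  have P: "?P \<in> pg_points" "?P \<subseteq> l" "?P \<subseteq> m"
    using v l m by (auto simp: pg_points_def vec.span_minimal)
  have "\<not> ?P \<subseteq> \<pi>"
  proof
    assume "?P \<subseteq> \<pi>"
    then have "?P \<in> points_at_infinity \<pi>" using P by (simp add: points_at_infinity_def)
    then have "l \<inter> \<pi> = ?P" "m \<inter> \<pi> = ?P" using direction_eq_iff P assms(1,2) by simp_all
    then show False using e assms by simp
  qed
  then show "\<not> ag_disjoint \<pi> m l"
    using P by (auto simp: ag_disjoint_def ag_points_def)
qed

text \<open>The plane through the two parallel lines meets the plane at infinity in a line. The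
  directions counted are its \<open>CARD('a) + 1\<close> points other than the common direction of
  \<open>l\<close> and \<open>m\<close>.\<close>

lemma card_coplanar_directions:
  assumes "l \<in> ag_lines \<pi>" "m \<in> ag_lines \<pi>" "m \<noteq> l" "l \<inter> \<pi> \<subseteq> m"
  shows "card {e \<in> points_at_infinity \<pi> - {l \<inter> \<pi>}. m \<subseteq> join l e} = CARD('a)"
proof -
  note l = ag_linesD[OF assms(1)] and m = ag_linesD[OF assms(2)]
  let ?d = "l \<inter> \<pi>" and ?\<tau> = "join l m"
  have d: "?d \<in> points_at_infinity \<pi>" using direction_in_points_at_infinity assms by blast
  have "\<not> m \<subseteq> l" using subspace_eqI[of m l] l m assms(3,4) by auto
  have "l \<inter> m = ?d"
  proof -
    have "vec.subspace (l \<inter> m)" using l m assms(3,4) by (simp add: vec.subspace_inter)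
    moreover have "\<not> vec.dim (l \<inter> m) \<ge> 2"
      using subspace_eqI[of "l \<inter> m" m] l m assms(3,4) \<open>\<not> m \<subseteq> l\<close> \<open>vec.subspace (l \<inter> m)\<close> by auto
    ultimately show ?thesis
      using subspace_eqI[of ?d "l \<inter> m"] d assms by (auto simp: points_at_infinity_def pg_points_def)
  qed
  then have \<tau>: "vec.dim ?\<tau> = 3"
    using dim_join[of l m] l m d
    by (simp add: points_at_infinity_def pg_points_def)
  have "\<not> ?\<tau> \<subseteq> \<pi>" using join_upper(1)[of l m] l by blast
  then have "vec.dim (?\<tau> \<inter> \<pi>) = 2" using dim_Int_\<pi>[of ?\<tau>] \<tau> by simp
  then have "card {P \<in> pg_points. P \<subseteq> ?\<tau> \<inter> \<pi>} = CARD('a) + 1"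
    using card_points_in_line[of "?\<tau> \<inter> \<pi>"] subspace_\<pi> by (simp add: vec.subspace_inter)
  moreover have "{e \<in> points_at_infinity \<pi> - {?d}. m \<subseteq> join l e}
      = {P \<in> pg_points. P \<subseteq> ?\<tau> \<inter> \<pi>} - {?d}"
  proof -
    \<comment> \<open>Both \<open>join l e\<close> and \<open>join l m\<close> are planes, so either
      inclusion forces them to coincide.\<close>
    have "m \<subseteq> join l e \<longleftrightarrow> e \<subseteq> ?\<tau>" if e: "e \<in> points_at_infinity \<pi>" "e \<noteq> ?d" for e
    proof
      assume "m \<subseteq> join l e"
      then have "?\<tau> = join l e"
        using dim_join_line_infinity[of l e] join_upper \<tau> e assms by (intro join_eqI) auto
      then show "e \<subseteq> ?\<tau>" using join_upper by simp
    next
      assume "e \<subseteq> ?\<tau>"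
      then have "join l e = ?\<tau>"
        using dim_join_line_infinity[of l e] join_upper \<tau> e assms by (intro join_eqI) auto
      then show "m \<subseteq> join l e" using join_upper by simp
    qed
    then show ?thesis by (auto simp: points_at_infinity_def)
  qed
  moreover have "?d \<in> {P \<in> pg_points. P \<subseteq> ?\<tau> \<inter> \<pi>}"
    using d join_upper[of l m] by (auto simp: points_at_infinity_def)
  ultimately show ?thesis by simp
qed

section \<open>Line spreads obtained by switching directions\<close>

text \<open>A line of direction \<open>d\<close> with an affine point in \<open>\<tau>\<close> lies
  in \<open>\<tau>\<close>, since \<open>d\<close> does. So the points outside \<open>\<tau>\<close>
  are exactly those covered by the lines of direction \<open>d\<close> outside
  \<open>\<tau>\<close>, and the lines of direction \<open>e\<close> inside cover the rest.\<close>

lemma line_spread_switched: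
  assumes d: "d \<in> points_at_infinity \<pi>" "d \<subseteq> \<tau>" and e: "e \<in> points_at_infinity \<pi>" "e \<subseteq> \<tau>"
    and \<tau>: "vec.subspace \<tau>"
  shows "line_spread \<pi> {l \<in> ag_lines \<pi>. if l \<subseteq> \<tau> then e \<subseteq> l else d \<subseteq> l}" (is "line_spread \<pi> ?S")
proof -
  have mixed: "ag_disjoint \<pi> l m"
    if "l \<in> ag_lines \<pi>" "m \<in> ag_lines \<pi>" "l \<subseteq> \<tau>" "\<not> m \<subseteq> \<tau>" "d \<subseteq> m" for l m
  proof (rule ccontr)
    assume "\<not> ag_disjoint \<pi> l m"
    then obtain P where P: "P \<in> ag_points \<pi>" "P \<subseteq> l" "P \<subseteq> m" by (auto simp: ag_disjoint_def)
    have "m = join P d"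
      using ag_lines_eqI[of m "join P d" P d] join_in_ag_lines join_upper P d that by blast
    then have "m \<subseteq> \<tau>" using join_least[OF \<tau>, of P d] P that d by blast
    with that show False by simp
  qed
  have "ag_disjoint \<pi> l m" if "l \<in> ?S" "m \<in> ?S" "l \<noteq> m" for l m
    using that ag_disjoint_parallel[of l m d] ag_disjoint_parallel[of l m e] mixed[of l m]
      mixed[of m l] d e ag_disjoint_sym[of l m] by (auto split: if_splits)
  then have spread: "partial_line_spread \<pi> ?S"
    by (auto simp: partial_line_spread_def pairwise_def)
  have "\<exists>l\<in>?S. P \<subseteq> l" if P: "P \<in> ag_points \<pi>" for P
  proof (cases "P \<subseteq> \<tau>")
    case True
    then have "join P e \<subseteq> \<tau>" using join_least[OF \<tau>] e by blast
    then show ?thesis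
      using join_in_ag_lines[OF P e(1)] join_upper[of P e] join_upper(2)[of e P] by (intro bexI[of _ "join P e"]) auto
  next
    case False
    then have "\<not> join P d \<subseteq> \<tau>" using join_upper[of P d] by blast
    then show ?thesis
      using join_in_ag_lines[OF P d(1)] join_upper[of P d] join_upper(2)[of d P] by (intro bexI[of _ "join P d"]) auto
  qed
  then have "covered_points \<pi> ?S = ag_points \<pi>"
    unfolding covered_points_def by blast
  with spread show ?thesis unfolding line_spread_def by blast
qed

lemma line_spread_parallel_class:
  assumes "d \<in> points_at_infinity \<pi>"
  shows "line_spread \<pi> {l \<in> ag_lines \<pi>. d \<subseteq> l}"
  \<comment> \<open>With the whole space as \<open>\<tau>\<close> and both directions equal, the
    condition reduces to \<open>d \<subseteq> l\<close>.\<close>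
  using line_spread_switched[OF assms _ assms, of UNIV] by simp

text \<open>The switched spread for \<open>e\<close> and the one with \<open>e\<close> replaced by
  \<open>d\<close> have the same lines outside \<open>\<tau>\<close>, so their parts inside
  \<open>\<tau>\<close> contain equally many lines of \<open>\<L>\<close>.\<close>

lemma card_parallel_in_plane_eq:
  assumes L: "\<L> \<subseteq> ag_lines \<pi>"
    and spread: "\<And>\<S>. line_spread \<pi> \<S> \<Longrightarrow> card (\<L> \<inter> \<S>) = x"
    and d: "d \<in> points_at_infinity \<pi>" "d \<subseteq> \<tau>" and e: "e \<in> points_at_infinity \<pi>" "e \<subseteq> \<tau>"
    and \<tau>: "vec.subspace \<tau>"
  shows "card {l \<in> \<L>. l \<subseteq> \<tau> \<and> e \<subseteq> l} = card {l \<in> \<L>. l \<subseteq> \<tau> \<and> d \<subseteq> l}"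
proof -
  let ?D = "{l \<in> \<L>. \<not> l \<subseteq> \<tau> \<and> d \<subseteq> l}"
  have "\<L> \<inter> {l \<in> ag_lines \<pi>. if l \<subseteq> \<tau> then e' \<subseteq> l else d \<subseteq> l} = {l \<in> \<L>. l \<subseteq> \<tau> \<and> e' \<subseteq> l} \<union> ?D" for e'
    using L by auto
  then have x: "card ({l \<in> \<L>. l \<subseteq> \<tau> \<and> e' \<subseteq> l} \<union> ?D) = x"
    if "e' \<in> points_at_infinity \<pi>" "e' \<subseteq> \<tau>" for e'
    using spread[OF line_spread_switched[OF d that \<tau>]] by simp
  have "card ({l \<in> \<L>. l \<subseteq> \<tau> \<and> e' \<subseteq> l} \<union> ?D) = card {l \<in> \<L>. l \<subseteq> \<tau> \<and> e' \<subseteq> l} + card ?D" for e'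
    by (intro card_Un_disjoint) auto
  from this[of d] this[of e] x[OF d] x[OF e] show ?thesis by linarith
qed

section \<open>Counting the lines that meet a given line\<close>

text \<open>The meeting lines are sorted by direction \<open>e\<close>; each count is moved within
  \<open>join l e\<close> to the direction of \<open>l\<close>, and the resulting pairs of a line
  parallel to \<open>l\<close> and a direction are counted the other way round.\<close>

lemma card_meeting_lines:
  assumes L: "\<L> \<subseteq> ag_lines \<pi>" and l: "l \<in> ag_lines \<pi>"
    and spread: "\<And>\<S>. line_spread \<pi> \<S> \<Longrightarrow> card (\<L> \<inter> \<S>) = x"
  shows "card {m \<in> \<L>. m \<noteq> l \<and> \<not> ag_disjoint \<pi> m l} = CARD('a) * x + CARD('a)^2 * of_bool (l \<in> \<L>)"
proof -
  let ?d = "l \<inter> \<pi>" and ?q = "CARD('a)"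
  let ?E = "points_at_infinity \<pi> - {?d}" and ?Ld = "{m \<in> \<L>. ?d \<subseteq> m}"
  have d: "?d \<in> points_at_infinity \<pi>" using direction_in_points_at_infinity l by blast
  have E: "card ?E = ?q^2 + ?q" using card_points_at_infinity d by simp
  have "{m \<in> \<L>. m \<noteq> l \<and> \<not> ag_disjoint \<pi> m l} = (\<Union>e\<in>?E. {m \<in> \<L>. m \<subseteq> join l e \<and> e \<subseteq> m})"
    (is "?M = ?U")
  proof (intro equalityI subsetI)
    fix m assume m: "m \<in> ?M"
    then have mL: "m \<in> ag_lines \<pi>" using L by blast
    let ?e = "m \<inter> \<pi>"
    have e: "?e \<in> points_at_infinity \<pi>" using direction_in_points_at_infinity mL by blast
    have "?e \<noteq> ?d"
    proof
      assume "?e = ?d"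
      then have "?d \<subseteq> m" by blast
      then show False using ag_disjoint_parallel[OF mL l _ d] m by auto
    qed
    then show "m \<in> ?U"
      using e m meet_iff_coplanar[OF l mL e] by auto
  next
    fix m assume "m \<in> ?U"
    then obtain e where e: "e \<in> ?E" "m \<in> \<L>" "m \<subseteq> join l e" "e \<subseteq> m" by blast
    moreover have "m \<noteq> l" using direction_eq_iff[of l e] e l by auto
    ultimately show "m \<in> ?M"
      using meet_iff_coplanar[OF l, of m e] L by blast
  qed
  also have "card ?U = (\<Sum>e\<in>?E. card {m \<in> \<L>. m \<subseteq> join l e \<and> e \<subseteq> m})"
  proof (intro card_UN_disjoint ballI impI)
    fix e e' assume *: "e \<in> ?E" "e' \<in> ?E" "e \<noteq> e'"
    have False if "m \<in> \<L>" "e \<subseteq> m" "e' \<subseteq> m" for m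
      using direction_eq_iff[of m e] direction_eq_iff[of m e'] that * L by auto
    then show "{m \<in> \<L>. m \<subseteq> join l e \<and> e \<subseteq> m} \<inter> {m \<in> \<L>. m \<subseteq> join l e' \<and> e' \<subseteq> m} = {}"
      by blast
  qed auto
  also have "\<dots> = (\<Sum>e\<in>?E. card {m \<in> ?Ld. m \<subseteq> join l e})"
  proof (intro sum.cong refl)
    fix e assume "e \<in> ?E"
    then have "card {m \<in> \<L>. m \<subseteq> join l e \<and> e \<subseteq> m} = card {m \<in> \<L>. m \<subseteq> join l e \<and> ?d \<subseteq> m}"
      using join_upper(1)[of l e] join_upper(2)[of e l] d by (intro card_parallel_in_plane_eq[OF L spread]) auto
    also have "{m \<in> \<L>. m \<subseteq> join l e \<and> ?d \<subseteq> m} = {m \<in> ?Ld. m \<subseteq> join l e}" by blast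
    finally show "card {m \<in> \<L>. m \<subseteq> join l e \<and> e \<subseteq> m} = card {m \<in> ?Ld. m \<subseteq> join l e}" .
  qed
  \<comment> \<open>A parallel \<open>m \<noteq> l\<close> lies in \<open>join l e\<close> for
    \<open>?q\<close> directions \<open>e\<close>, but \<open>l\<close> itself for all
    \<open>?q^2 + ?q\<close>; this is the source of the extra \<open>?q^2\<close>.\<close>
  also have "\<dots> = (\<Sum>m\<in>?Ld. ?q + of_bool (m = l) * ?q^2)"
  proof (rule sum_multicount_gen; (intro ballI)?)
    fix m assume m: "m \<in> ?Ld"
    show "card {e \<in> ?E. m \<subseteq> join l e} = ?q + of_bool (m = l) * ?q^2"
    proof (cases "m = l")
      case True
      then have "{e \<in> ?E. m \<subseteq> join l e} = ?E" using join_upper by auto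
      then show ?thesis using E True by simp
    next
      case False
      then show ?thesis using card_coplanar_directions[OF l, of m] m L by auto
    qed
  qed auto
  also have "\<dots> = card ?Ld * ?q + (\<Sum>m\<in>?Ld. if m = l then ?q^2 else 0)"
    by (simp add: sum.distrib of_bool_def if_distrib[of "\<lambda>x. x * _"] cong: if_cong)
  also have "card ?Ld = x"
  proof -
    have "?Ld = \<L> \<inter> {m \<in> ag_lines \<pi>. ?d \<subseteq> m}" using L by blast
    then show ?thesis using spread[OF line_spread_parallel_class[OF d]] by simp
  qed
  also have "(\<Sum>m\<in>?Ld. if m = l then ?q^2 else 0) = ?q^2 * of_bool (l \<in> \<L>)"
    by (simp add: sum.delta)
  finally show ?thesis by (simp add: mult.commute)
qed

lemma ag_line_not_disjoint_self:
  assumes "l \<in> ag_lines \<pi>"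
  shows "\<not> ag_disjoint \<pi> l l"
proof -
  have "{P \<in> ag_points \<pi>. P \<subseteq> l} \<noteq> {}"
    using card_ag_points_in_line[OF assms] by (intro notI) simp
  then show ?thesis by (auto simp: ag_disjoint_def)
qed

lemma card_lines_split:
  assumes "l \<in> ag_lines \<pi>"
  shows "card \<L> = of_bool (l \<in> \<L>) + card {m \<in> \<L>. m \<noteq> l \<and> \<not> ag_disjoint \<pi> m l}
    + card {m \<in> \<L>. ag_disjoint \<pi> m l}" (is "_ = _ + card ?M + card ?D")
proof -
  have "card \<L> = card (({l} \<inter> \<L>) \<union> ?M \<union> ?D)"
    by (rule arg_cong[of _ _ card]) blast
  also have "\<dots> = card (({l} \<inter> \<L>) \<union> ?M) + card ?D"
    using ag_line_not_disjoint_self[OF assms] by (intro card_Un_disjoint) auto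
  also have "card (({l} \<inter> \<L>) \<union> ?M) = card ({l} \<inter> \<L>) + card ?M"
    by (intro card_Un_disjoint) auto
  finally show ?thesis by simp
qed

text \<open>Incident pairs of an affine point of \<open>l\<close> and a line of \<open>\<L>\<close>
  are counted by lines: \<open>l\<close> contributes all its points, another meeting line exactly
  one, a disjoint line none.\<close>

lemma sum_degrees_on_line:
  assumes L: "\<L> \<subseteq> ag_lines \<pi>" and l: "l \<in> ag_lines \<pi>"
  shows "(\<Sum>P | P \<in> ag_points \<pi> \<and> P \<subseteq> l. card {m \<in> \<L>. P \<subseteq> m})
    = CARD('a) * of_bool (l \<in> \<L>) + card {m \<in> \<L>. m \<noteq> l \<and> \<not> ag_disjoint \<pi> m l}"
proof -
  have "(\<Sum>P | P \<in> ag_points \<pi> \<and> P \<subseteq> l. card {m \<in> \<L>. P \<subseteq> m})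
    = (\<Sum>m\<in>\<L>. (if m = l then CARD('a) else 0) + of_bool (m \<noteq> l \<and> \<not> ag_disjoint \<pi> m l))"
  proof (rule sum_multicount_gen; (intro ballI)?)
    fix m assume m: "m \<in> \<L>"
    have *: "{P \<in> {P \<in> ag_points \<pi>. P \<subseteq> l}. P \<subseteq> m} = {P \<in> ag_points \<pi>. P \<subseteq> m \<and> P \<subseteq> l}" by blast
    consider "m = l" | "m \<noteq> l" "ag_disjoint \<pi> m l" | "m \<noteq> l" "\<not> ag_disjoint \<pi> m l" by blast
    then show "card {P \<in> {P \<in> ag_points \<pi>. P \<subseteq> l}. P \<subseteq> m}
      = (if m = l then CARD('a) else 0) + of_bool (m \<noteq> l \<and> \<not> ag_disjoint \<pi> m l)"
    proof cases
      case 1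
      then show ?thesis using card_ag_points_in_line[OF l] by simp
    next
      case 2
      then have "{P \<in> ag_points \<pi>. P \<subseteq> m \<and> P \<subseteq> l} = {}" by (auto simp: ag_disjoint_def)
      then show ?thesis unfolding * using 2 by simp
    next
      case 3
      then show ?thesis unfolding * using card_common_ag_points[of m l] m l L by auto
    qed
  qed auto
  also have "\<dots> = CARD('a) * of_bool (l \<in> \<L>) + card {m \<in> \<L>. m \<noteq> l \<and> \<not> ag_disjoint \<pi> m l}"
    by (simp add: sum.distrib sum.delta sum_of_bool_eq Int_def)
  finally show ?thesis .
qed

text \<open>Every affine line has exactly one direction, so the parallel classes partition
  \<open>\<L>\<close>.\<close>

lemma card_parallel_classes:
  assumes L: "\<L> \<subseteq> ag_lines \<pi>"
  shows "card \<L> = (\<Sum>d\<in>points_at_infinity \<pi>. card (\<L> \<inter> {l \<in> ag_lines \<pi>. d \<subseteq> l}))"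
proof -
  have "\<exists>d\<in>points_at_infinity \<pi>. d \<subseteq> m" if "m \<in> \<L>" for m
    using L that direction_in_points_at_infinity[of m] by (intro bexI[of _ "m \<inter> \<pi>"]) auto
  then have "\<L> = (\<Union>d\<in>points_at_infinity \<pi>. \<L> \<inter> {l \<in> ag_lines \<pi>. d \<subseteq> l})"
    using L by blast
  then have "card \<L> = card (\<Union>d\<in>points_at_infinity \<pi>. \<L> \<inter> {l \<in> ag_lines \<pi>. d \<subseteq> l})"
    by (rule arg_cong)
  also have "\<dots> = (\<Sum>d\<in>points_at_infinity \<pi>. card (\<L> \<inter> {l \<in> ag_lines \<pi>. d \<subseteq> l}))"
  proof (intro card_UN_disjoint ballI impI)
    fix d e assume *: "d \<in> points_at_infinity \<pi>" "e \<in> points_at_infinity \<pi>" "d \<noteq> e"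
    have False if "m \<in> ag_lines \<pi>" "d \<subseteq> m" "e \<subseteq> m" for m
      using direction_eq_iff[of m d] direction_eq_iff[of m e] that * by auto
    then show "\<L> \<inter> {l \<in> ag_lines \<pi>. d \<subseteq> l} \<inter> (\<L> \<inter> {l \<in> ag_lines \<pi>. e \<subseteq> l}) = {}" by blast
  qed auto
  finally show ?thesis .
qed

section \<open>Switching sets and the kernel of the incidence matrix\<close>

lemma partial_line_spread_unique:
  assumes "partial_line_spread \<pi> \<R>" "l \<in> \<R>" "m \<in> \<R>" "P \<in> ag_points \<pi>" "P \<subseteq> l" "P \<subseteq> m"
  shows "l = m"
  using assms unfolding partial_line_spread_def pairwise_def ag_disjoint_def by blast

text \<open>A point on a line \<open>l\<close> of one spread only also lies on some line
  \<open>m\<close> of the other. This \<open>m\<close> is not in the first spread, where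
  \<open>l\<close> is the only line through the point.\<close>

lemma conjugated_switching_sets_spreads:
  assumes "line_spread \<pi> \<S>" "line_spread \<pi> \<S>'"
  shows "conjugated_switching_sets \<pi> (\<S> - \<S>') (\<S>' - \<S>)"
proof -
  have *: "covered_points \<pi> (S - T) \<subseteq> covered_points \<pi> (T - S)"
    if S: "line_spread \<pi> S" and T: "line_spread \<pi> T" for S T
  proof
    fix P assume "P \<in> covered_points \<pi> (S - T)"
    then obtain l where l: "P \<in> ag_points \<pi>" "l \<in> S - T" "P \<subseteq> l" by (auto simp: covered_points_def)
    then have "P \<in> covered_points \<pi> T" using T by (simp add: line_spread_def)
    then obtain m where m: "m \<in> T" "P \<subseteq> m" unfolding covered_points_def by blast
    have "m \<notin> S"
      using partial_line_spread_unique[of S l m P] l m S unfolding line_spread_def by blast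
    then show "P \<in> covered_points \<pi> (T - S)" using l m by (auto simp: covered_points_def)
  qed
  then have "covered_points \<pi> (\<S> - \<S>') = covered_points \<pi> (\<S>' - \<S>)" using assms by blast
  then show ?thesis
    using assms unfolding conjugated_switching_sets_def line_spread_def partial_line_spread_def
    by (auto intro: pairwise_subset)
qed

text \<open>The sum counts the lines of \<open>\<R>\<close> through \<open>P\<close>, of which there
  is at most one.\<close>

lemma sum_incidence_indicator:
  assumes R: "partial_line_spread \<pi> \<R>" and P: "P \<in> ag_points \<pi>"
  shows "(\<Sum>l\<in>ag_lines \<pi>. incidence_matrix P l * indicator \<R> l) = indicator (covered_points \<pi> \<R>) P"
proof -
  have "\<R> \<subseteq> ag_lines \<pi>" using R by (simp add: partial_line_spread_def)
  then have "(\<Sum>l\<in>ag_lines \<pi>. incidence_matrix P l * indicator \<R> l) = (\<Sum>l\<in>\<R>. incidence_matrix P l)"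
    by (simp add: sum.inter_restrict[symmetric] indicator_def if_distrib Int_absorb1 cong: if_cong)
  also have "\<dots> = (\<Sum>l\<in>\<R>. of_bool (P \<subseteq> l))" by (simp add: incidence_matrix_def of_bool_def)
  also have "\<dots> = of_nat (card {l \<in> \<R>. P \<subseteq> l})" by (simp add: sum_of_bool_eq Int_def)
  also have "\<dots> = indicator (covered_points \<pi> \<R>) P"
  proof (cases "P \<in> covered_points \<pi> \<R>")
    case True
    then obtain l where l: "l \<in> \<R>" "P \<subseteq> l" by (auto simp: covered_points_def)
    then have "{l \<in> \<R>. P \<subseteq> l} = {l}"
      using partial_line_spread_unique[OF R l(1) _ P l(2)] by blast
    then show ?thesis using True by simp
  next
    case False
    then have "{l \<in> \<R>. P \<subseteq> l} = {}" using P by (auto simp: covered_points_def)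
    then show ?thesis using False by simp
  qed
  finally show ?thesis .
qed

text \<open>Equal covered points put the difference \<open>?w\<close> of the two characteristic
  vectors into the kernel; its inner product with that of \<open>\<L>\<close> is the difference of
  the two cardinalities.\<close>

lemma orth_compl_imp_switching:
  assumes orth: "indicator \<L> \<in> orth_compl (ag_lines \<pi>)
        (mat_ker (ag_points \<pi>) (ag_lines \<pi>) incidence_matrix)"
    and conj: "conjugated_switching_sets \<pi> \<R> \<R>'"
  shows "card (\<L> \<inter> \<R>) = card (\<L> \<inter> \<R>')"
proof -
  let ?w = "\<lambda>l. indicator \<R> l - indicator \<R>' l :: complex"
  have R: "partial_line_spread \<pi> \<R>" "partial_line_spread \<pi> \<R>'"
    and cover: "covered_points \<pi> \<R> = covered_points \<pi> \<R>'"
    using conj by (auto simp: conjugated_switching_sets_def)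
  then have sub: "\<R> \<subseteq> ag_lines \<pi>" "\<R>' \<subseteq> ag_lines \<pi>" by (auto simp: partial_line_spread_def)
  have "?w \<in> cvectors (ag_lines \<pi>)"
    using sub by (auto simp: cvectors_def indicator_def)
  moreover have "(\<Sum>l\<in>ag_lines \<pi>. incidence_matrix P l * ?w l) = 0" if "P \<in> ag_points \<pi>" for P
    using sum_incidence_indicator[OF R(1) that] sum_incidence_indicator[OF R(2) that] cover
    by (simp add: right_diff_distrib sum_subtractf)
  ultimately have "?w \<in> mat_ker (ag_points \<pi>) (ag_lines \<pi>) incidence_matrix"
    by (simp add: mat_ker_def)
  then have "(\<Sum>l\<in>ag_lines \<pi>. indicator \<L> l * cnj (?w l)) = 0"
    using orth by (simp only: orth_compl_def mem_Collect_eq)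
  moreover have "cnj (?w l) = ?w l" for l by (simp add: indicator_def)
  ultimately have zero: "(\<Sum>l\<in>ag_lines \<pi>. indicator \<L> l * ?w l) = 0" by (simp only:)
  have count: "(\<Sum>l\<in>ag_lines \<pi>. indicator \<L> l * indicator S l) = (of_nat (card (\<L> \<inter> S)) :: complex)"
    if "S \<subseteq> ag_lines \<pi>" for S
  proof -
    have "(\<Sum>l\<in>ag_lines \<pi>. indicator \<L> l * indicator S l) = (\<Sum>l\<in>ag_lines \<pi>. indicator (\<L> \<inter> S) l :: complex)"
      by (simp add: indicator_inter_arith)
    also have "\<dots> = of_nat (card (ag_lines \<pi> \<inter> (\<L> \<inter> S)))"
      by (simp add: indicator_def sum.If_cases Int_def)
    also have "ag_lines \<pi> \<inter> (\<L> \<inter> S) = \<L> \<inter> S" using that by blast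
    finally show ?thesis .
  qed
  have "of_nat (card (\<L> \<inter> \<R>)) - of_nat (card (\<L> \<inter> \<R>')) = (0 :: complex)"
    unfolding count[OF sub(1), symmetric] count[OF sub(2), symmetric] zero[symmetric]
    by (simp only: right_diff_distrib sum_subtractf)
  then show ?thesis by simp
qed

section \<open>Implications between the properties\<close>

text \<open>Any two spreads share the same number of lines with \<open>\<L>\<close>. Summing this
  number over all parallel classes gives \<open>card \<L>\<close>, which determines it as
  \<open>x\<close>.\<close>

lemma switching_imp_spreads:
  assumes L: "\<L> \<subseteq> ag_lines \<pi>" and card: "card \<L> = x * (CARD('a)^2 + CARD('a) + 1)"
    and switch: "\<And>\<R> \<R>'. conjugated_switching_sets \<pi> \<R> \<R>' \<Longrightarrow> card (\<L> \<inter> \<R>) = card (\<L> \<inter> \<R>')"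
    and S: "line_spread \<pi> \<S>"
  shows "card (\<L> \<inter> \<S>) = x"
proof -
  have eq: "card (\<L> \<inter> T) = card (\<L> \<inter> \<S>)" if T: "line_spread \<pi> T" for T
  proof -
    have split: "card (\<L> \<inter> A) = card (\<L> \<inter> A \<inter> B) + card (\<L> \<inter> (A - B))" for A B
    proof -
      have "card (\<L> \<inter> A) = card ((\<L> \<inter> A \<inter> B) \<union> (\<L> \<inter> (A - B)))"
        by (rule arg_cong[where f = card]) blast
      also have "\<dots> = card (\<L> \<inter> A \<inter> B) + card (\<L> \<inter> (A - B))"
        by (rule card_Un_disjoint) auto
      finally show ?thesis .
    qed
    \<comment> \<open>The common lines of the spreads contribute equally; what remains are
      conjugated switching sets.\<close>
    have "\<L> \<inter> T \<inter> \<S> = \<L> \<inter> \<S> \<inter> T" by blast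
    then show ?thesis
      using split[of T \<S>] split[of \<S> T] switch[OF conjugated_switching_sets_spreads[OF T S]] by simp
  qed
  have "card \<L> = (\<Sum>d\<in>points_at_infinity \<pi>. card (\<L> \<inter> {l \<in> ag_lines \<pi>. d \<subseteq> l}))"
    by (rule card_parallel_classes[OF L])
  also have "\<dots> = (\<Sum>d\<in>points_at_infinity \<pi>. card (\<L> \<inter> \<S>))"
    by (intro sum.cong refl eq line_spread_parallel_class)
  also have "\<dots> = card (\<L> \<inter> \<S>) * (CARD('a)^2 + CARD('a) + 1)"
    using card_points_at_infinity by simp
  finally have "x * (CARD('a)^2 + CARD('a) + 1) = card (\<L> \<inter> \<S>) * (CARD('a)^2 + CARD('a) + 1)"
    using card by simp
  then have "x = card (\<L> \<inter> \<S>)" unfolding mult_cancel2 by simp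
  then show ?thesis ..
qed

text \<open>Subtracting \<open>l\<close> itself, if it belongs to \<open>\<L>\<close>, and the lines
  meeting it from \<open>card \<L>\<close> leaves the disjoint ones. Integers make
  \<open>x - of_bool (l \<in> \<L>)\<close> a true difference.\<close>

lemma spreads_imp_card_disjoint:
  assumes L: "\<L> \<subseteq> ag_lines \<pi>" and card: "card \<L> = x * (CARD('a)^2 + CARD('a) + 1)"
    and spread: "\<And>\<S>. line_spread \<pi> \<S> \<Longrightarrow> card (\<L> \<inter> \<S>) = x" and l: "l \<in> ag_lines \<pi>"
  shows "int (card {m \<in> \<L>. ag_disjoint \<pi> m l})
    = (int CARD('a) ^ 2 + 1) * (int x - of_bool (l \<in> \<L>))"
proof -
  have "int (x * (CARD('a)^2 + CARD('a) + 1)) = int (of_bool (l \<in> \<L>)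
    + (CARD('a) * x + CARD('a)^2 * of_bool (l \<in> \<L>)) + card {m \<in> \<L>. ag_disjoint \<pi> m l})"
    using card_lines_split[OF l, of \<L>] card_meeting_lines[OF L l spread] card by metis
  then show ?thesis by (auto simp: algebra_simps)
qed

lemma card_disjoint_imp_im:
  assumes L: "\<L> \<subseteq> ag_lines \<pi>" and card: "card \<L> = x * (CARD('a)^2 + CARD('a) + 1)"
    and disj: "\<And>l. l \<in> ag_lines \<pi> \<Longrightarrow> int (card {m \<in> \<L>. ag_disjoint \<pi> m l})
      = (int CARD('a) ^ 2 + 1) * (int x - of_bool (l \<in> \<L>))"
  shows "indicator \<L> \<in> mat_im (ag_lines \<pi>) (ag_points \<pi>) (mat_transpose incidence_matrix)"
proof -
  let ?q = "CARD('a)" and ?deg = "\<lambda>P. card {m \<in> \<L>. P \<subseteq> m}"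
  \<comment> \<open>Over the points of \<open>l\<close> the excesses \<open>?deg P - x\<close> add
    up to \<open>?q^2 + ?q\<close> or \<open>0\<close>, which dictates the denominator. The value
    \<open>0\<close> elsewhere places \<open>v\<close> in
    \<open>cvectors (ag_points \<pi>)\<close>.\<close>
  define v :: "'a pg \<Rightarrow> complex" where
    "v P = (if P \<in> ag_points \<pi> then (of_nat (?deg P) - of_nat x) / of_nat (?q^2 + ?q) else 0)" for P
  have deg: "(\<Sum>P | P \<in> ag_points \<pi> \<and> P \<subseteq> l. ?deg P) = ?q * x + (?q^2 + ?q) * of_bool (l \<in> \<L>)"
    if l: "l \<in> ag_lines \<pi>" for l
  proof -
    let ?M = "card {m \<in> \<L>. m \<noteq> l \<and> \<not> ag_disjoint \<pi> m l}"
    \<comment> \<open>The previous count run backwards: the number of disjoint lines determines the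
      number \<open>?M\<close> of meeting ones.\<close>
    have "int (x * (?q^2 + ?q + 1)) = of_bool (l \<in> \<L>) + int ?M
      + (int ?q ^ 2 + 1) * (int x - of_bool (l \<in> \<L>))"
      using card_lines_split[OF l, of \<L>] disj[OF l] card by simp
    then have "int ?M = int (?q * x + ?q^2 * of_bool (l \<in> \<L>))"
      by (auto simp: algebra_simps)
    then have "?M = ?q * x + ?q^2 * of_bool (l \<in> \<L>)" by (simp only: of_nat_eq_iff)
    then show ?thesis using sum_degrees_on_line[OF L l] by (simp add: algebra_simps)
  qed
  have "indicator \<L> l = (\<Sum>P\<in>ag_points \<pi>. mat_transpose incidence_matrix l P * v P)"
    if l: "l \<in> ag_lines \<pi>" for l
  proof -
    have "(\<Sum>P\<in>ag_points \<pi>. mat_transpose incidence_matrix l P * v P)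
      = (\<Sum>P\<in>ag_points \<pi>. if P \<subseteq> l then v P else 0)"
      by (intro sum.cong) (auto simp: mat_transpose_def incidence_matrix_def)
    also have "\<dots> = (\<Sum>P | P \<in> ag_points \<pi> \<and> P \<subseteq> l. v P)"
      by (rule sum.inter_filter[symmetric]) simp
    also have "\<dots> = (\<Sum>P | P \<in> ag_points \<pi> \<and> P \<subseteq> l. (of_nat (?deg P) - of_nat x) / of_nat (?q^2 + ?q))"
      by (intro sum.cong) (auto simp: v_def)
    also have "\<dots> = (of_nat (\<Sum>P | P \<in> ag_points \<pi> \<and> P \<subseteq> l. ?deg P) - of_nat (?q * x)) / of_nat (?q^2 + ?q)"
      using card_ag_points_in_line[OF l] by (simp add: sum_divide_distrib[symmetric] sum_subtractf)
    also have "\<dots> = of_nat ((?q^2 + ?q) * of_bool (l \<in> \<L>)) / of_nat (?q^2 + ?q)"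
      unfolding deg[OF l] by simp
    also have "\<dots> = of_bool (l \<in> \<L>)"
    proof -
      have "(of_nat (?q^2 + ?q) :: complex) \<noteq> 0"
        using CARD_field_ge_2[where 'a='a] unfolding of_nat_eq_0_iff by simp
      then show ?thesis unfolding of_nat_mult by simp
    qed
    finally show ?thesis by (simp add: indicator_def)
  qed
  moreover have "indicator \<L> \<in> cvectors (ag_lines \<pi>)" "v \<in> cvectors (ag_points \<pi>)"
    using L by (auto simp: cvectors_def indicator_def v_def)
  ultimately show ?thesis unfolding mat_im_def by blast
qed

end

theorem theorem4p1:
  fixes \<pi> :: "'a::{field,finite} pg" and \<L> :: "'a pg set" and q x :: nat
  assumes "q = CARD('a)"
    and "\<pi> \<in> pg_planes"
    and "x > 0"
    and "\<L> \<subseteq> ag_lines \<pi>"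
    and "card \<L> = x * (q^2 + q + 1)"
  shows "all_equivalent
    [ \<forall>\<S>. line_spread \<pi> \<S> \<longrightarrow> card (\<L> \<inter> \<S>) = x,
      indicator \<L> \<in> orth_compl (ag_lines \<pi>)
        (mat_ker (ag_points \<pi>) (ag_lines \<pi>) incidence_matrix),
      indicator \<L> \<in> mat_im (ag_lines \<pi>) (ag_points \<pi>) (mat_transpose incidence_matrix),
      \<forall>\<R> \<R>'. conjugated_switching_sets \<pi> \<R> \<R>' \<longrightarrow> card (\<L> \<inter> \<R>) = card (\<L> \<inter> \<R>'),
      (\<forall>l \<in> ag_lines \<pi>. int (card {m \<in> \<L>. ag_disjoint \<pi> m l})
           = (int q ^ 2 + 1) * (int x - indicator \<L> l))
        \<and> (\<forall>P \<in> points_at_infinity \<pi>. card {l \<in> \<L>. P \<subseteq> l} = x) ]"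
proof -
  interpret affine_space \<pi> by (unfold_locales) (rule assms)
  have card: "card \<L> = x * (CARD('a)^2 + CARD('a) + 1)" using assms by simp
  note L = \<open>\<L> \<subseteq> ag_lines \<pi>\<close>
  let ?spread = "\<forall>\<S>. line_spread \<pi> \<S> \<longrightarrow> card (\<L> \<inter> \<S>) = x"
  let ?orth = "indicator \<L> \<in> orth_compl (ag_lines \<pi>)
        (mat_ker (ag_points \<pi>) (ag_lines \<pi>) incidence_matrix)"
  let ?im = "indicator \<L> \<in> mat_im (ag_lines \<pi>) (ag_points \<pi>) (mat_transpose incidence_matrix)"
  let ?switch = "\<forall>\<R> \<R>'. conjugated_switching_sets \<pi> \<R> \<R>' \<longrightarrow> card (\<L> \<inter> \<R>) = card (\<L> \<inter> \<R>')"
  let ?disj = "\<forall>l \<in> ag_lines \<pi>. int (card {m \<in> \<L>. ag_disjoint \<pi> m l})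
           = (int q ^ 2 + 1) * (int x - indicator \<L> l)"
  let ?inf = "\<forall>P \<in> points_at_infinity \<pi>. card {l \<in> \<L>. P \<subseteq> l} = x"
  have ind: "indicator \<L> l = (of_bool (l \<in> \<L>) :: int)" for l by (simp add: indicator_def)
  have "mat_im (ag_lines \<pi>) (ag_points \<pi>) (mat_transpose incidence_matrix)
      \<subseteq> orth_compl (ag_lines \<pi>) (mat_ker (ag_points \<pi>) (ag_lines \<pi>) incidence_matrix)"
    by (rule mat_im_transpose_subset_orth_compl) (simp add: incidence_matrix_def)
  \<comment> \<open>The implications form a cycle from \<open>?im\<close> through
    \<open>?orth\<close>, \<open>?switch\<close>, \<open>?spread\<close> and \<open>?disj\<close>
    back to \<open>?im\<close>; \<open>?inf\<close> is derived from \<open>?spread\<close>.\<close>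
  then have "?im \<Longrightarrow> ?orth" by blast
  moreover have "?orth \<Longrightarrow> ?switch" using orth_compl_imp_switching by blast
  moreover have "?switch \<Longrightarrow> ?spread" using switching_imp_spreads[OF L card] by blast
  moreover have "?spread \<Longrightarrow> ?disj"
    using spreads_imp_card_disjoint[OF L card] unfolding ind \<open>q = CARD('a)\<close> by blast
  moreover have "?inf" if ?spread
  proof
    fix P assume P: "P \<in> points_at_infinity \<pi>"
    \<comment> \<open>The lines through a point at infinity form a parallel class, which is a
      spread.\<close>
    have "{l \<in> \<L>. P \<subseteq> l} = \<L> \<inter> {l \<in> ag_lines \<pi>. P \<subseteq> l}" using L by blast
    then show "card {l \<in> \<L>. P \<subseteq> l} = x" using that line_spread_parallel_class[OF P] by simp
  qed
  moreover have "?disj \<Longrightarrow> ?im"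
    using card_disjoint_imp_im[OF L card] unfolding ind \<open>q = CARD('a)\<close> by blast
  ultimately have "?spread \<longleftrightarrow> ?im" "?orth \<longleftrightarrow> ?im" "?switch \<longleftrightarrow> ?im" "?disj \<and> ?inf \<longleftrightarrow> ?im"
    by blast+
  then show ?thesis unfolding all_equivalent_def by simp
qed

end
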